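(* Let $X_N=\{\mathbf{x}_1,\dots,\mathbf{x}_N\}\subseteq\mathbb{S}^2$ and let $\mathcal{R}=\{R_j\}_{j=1}^N$ be an $X_N$-compatible partition of $\mathbb{S}^2$. Suppose the geometric quadrature $Q[X_N,\mathcal{R}]$ satisfies an $L^2$ Marcinkiewicz–Zygmund (MZ) inequality of degree $n\in\mathbb{N}_0$ with constants $A\le B$, that is, $$A\,I(f^2)\le Q[X_N,\mathcal{R}](f^2)\le B\,I(f^2)\qquad\forall\,f\in\mathbb{P}_n(\mathbb{S}^2).$$ Let $\mathbf{w}\in\mathbb{R}^N$ be an arbitrary weight vector. Then the quadrature $Q[X_N,\mathbf{w}]$ satisfies, for all $f\in\mathbb{P}_n(\mathbb{S}^2)$, $$\left(A-\frac{(n+1)\sqrt{B}}{\sqrt{4\pi}}\|\mathbf{w}\|_{\mathcal{R},2}\right)I(f^2)\le Q[X_N,\mathbf{w}](f^2)\le Q[X_N,|\mathbf{w}|](f^2)\le\left(B+\frac{(n+1)\sqrt{B}}{\sqrt{4\pi}}\|\mathbf{w}\|_{\mathcal{R},2}\right)I(f^2).$$ This chain of inequalities is both an $L^2$ MZ inequality and an $L^2$ MZ condition for $Q[X_N,\mathbf{w}]$.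
   Context: $\mathbb{S}^2$ is the unit sphere in $\mathbb{R}^3$ with surface measure $\omega$ of total mass $4\pi$, and $I(f)=\int_{\mathbb{S}^2}f\,d\omega$. $\mathbb{P}_n(\mathbb{S}^2)$ is the space of real spherical polynomials of degree at most $n$. For $\mathbf{w}\in\mathbb{R}^N$, $Q[X_N,\mathbf{w}](f):=\sum_{j=1}^Nw_jf(\mathbf{x}_j)$ and $|\mathbf{w}|:=(|w_1|,\dots,|w_N|)$. The quadrature $Q[X_N,\mathbf{w}]$ satisfies an $L^2$ MZ inequality of degree $n$ with constants $A,B$ if $A\le1\le B$ and $A\,I(f^2)\le Q[X_N,\mathbf{w}](f^2)\le B\,I(f^2)$ for all $f\in\mathbb{P}_n(\mathbb{S}^2)$; it satisfies an $L^2$ MZ condition of degree $n$ with constant $c\ge0$ if $Q[X_N,|\mathbf{w}|](f^2)\le c\,I(f^2)$ for all $f\in\mathbb{P}_n(\mathbb{S}^2)$. A partition of $\mathbb{S}^2$ is a finite collection $\mathcal{R}=\{R_1,\dots,R_N\}$ of closed, nonoverlapping (having no common interior points) subsets whose union is $\mathbb{S}^2$; it is $X_N$-compatible if each $R_j$ contains exactly one point $\mathbf{x}_j\in X_N$ in its interior. Its partition weight is $\mathbf{r}=(r_1,\dots,r_N)$ with $r_j:=\omega(R_j)$, and the geometric quadrature is $Q[X_N,\mathcal{R}]:=Q[X_N,\mathbf{r}]$. The $\chi^2$-divergence of $\mathbf{w}$ relative to $\mathcal{R}$ is $\|\mathbf{w}\|_{\mathcal{R},2}:=\left[\sum_{j=1}^N\frac{(w_j-r_j)^2}{r_j}\right]^{1/2}$.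 *)

theory Defs
  imports "HOL-Analysis.Analysis"
begin

abbreviation S2 :: "(real^3) set" where
  "S2 \<equiv> sphere 0 1"

text \<open>Surface measure as the cone measure: \<open>\<omega>(E) = 3 \<sqdot> vol {t y | 0 < t \<le> 1, y \<in> E}\<close> for Borel
  sets \<open>E\<close> of the sphere, i.e. the measure for which integration in polar coordinates
  \<open>dx = t\<^sup>2 dt d\<omega>(y)\<close> holds. The lemmas below confirm that it is the rotation-invariant Borel
  measure of total mass \<open>4\<pi>\<close>.\<close>

definition surface_measure :: "(real^3) measure" where
  "surface_measure = density
     (distr (restrict_space lborel (cball 0 1 - {0})) (restrict_space borel S2)
        (\<lambda>y. y /\<^sub>R norm y))
     (\<lambda>_. 3)"

lemma sets_surface_measure [simp, measurable_cong]:
  "sets surface_measure = sets (restrict_space borel S2)"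
  by (simp add: surface_measure_def)

lemma space_surface_measure [simp]: "space surface_measure = S2"
  by (simp add: surface_measure_def space_restrict_space)

lemma radial_projection_measurable:
  "(\<lambda>y. y /\<^sub>R norm y) \<in> restrict_space lborel (cball 0 1 - {0}) \<rightarrow>\<^sub>M restrict_space borel S2"
proof (rule measurable_restrict_space2)
  show "(\<lambda>y. y /\<^sub>R norm y) \<in> space (restrict_space lborel (cball 0 1 - {0})) \<rightarrow> S2"
    by (auto simp: space_restrict_space)
  show "(\<lambda>y::real^3. y /\<^sub>R norm y) \<in> restrict_space lborel (cball 0 1 - {0}) \<rightarrow>\<^sub>M borel"
    by (rule measurable_restrict_space1) measurable
qed

lemma emeasure_surface_measure:
  assumes "E \<in> sets (restrict_space borel S2)"
  shows "emeasure surface_measure E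
           = 3 * emeasure lborel {y \<in> cball 0 1 - {0}. y /\<^sub>R norm y \<in> E}"
proof -
  let ?M = "restrict_space lborel (cball 0 1 - {0}) :: (real^3) measure"
  have "emeasure surface_measure E
          = 3 * emeasure ?M ((\<lambda>y. y /\<^sub>R norm y) -` E \<inter> space ?M)"
    using assms unfolding surface_measure_def
    by (simp add: emeasure_density_const emeasure_distr[OF radial_projection_measurable])
  also have "(\<lambda>y. y /\<^sub>R norm y) -` E \<inter> space ?M = {y \<in> cball 0 1 - {0}. y /\<^sub>R norm y \<in> E}"
    by (auto simp: space_restrict_space)
  also have "emeasure ?M \<dots> = emeasure lborel {y \<in> cball 0 1 - {0}. y /\<^sub>R norm y \<in> E}"
    by (rule emeasure_restrict_space) auto
  finally show ?thesis .
qed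

lemma emeasure_surface_measure_S2: "emeasure surface_measure S2 = ennreal (4 * pi)"
proof -
  have "S2 \<in> sets (restrict_space borel S2)"
    by (metis sets.top sets_surface_measure space_surface_measure)
  then have "emeasure surface_measure S2
      = 3 * emeasure lborel {y \<in> cball (0::real^3) 1 - {0}. y /\<^sub>R norm y \<in> S2}"
    by (rule emeasure_surface_measure)
  also have "{y \<in> cball (0::real^3) 1 - {0}. y /\<^sub>R norm y \<in> S2} = cball 0 1 - {0}"
    by auto
  also have "emeasure lborel (cball (0::real^3) 1 - {0}) = emeasure lborel (cball (0::real^3) 1)"
    by (rule emeasure_Diff_null_set) auto
  also have "3 * \<dots> = ennreal (4 * pi)"
    by (simp add: emeasure_cball eval_unit_ball_vol flip: ennreal_numeral ennreal_mult)
  finally show ?thesis .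
qed

lemma surface_measure_rotation_invariant:
  assumes T: "orthogonal_transformation T" and E: "E \<in> sets surface_measure"
  shows "emeasure surface_measure (T ` E) = emeasure surface_measure E"
proof -
  define C where "C E = {y \<in> cball 0 1 - {0}. y /\<^sub>R norm y \<in> E}" for E :: "(real^3) set"
  have C_borel: "C E \<in> sets borel" if "E \<in> sets (restrict_space borel S2)" for E
  proof -
    have "E \<in> sets borel"
      using that by (auto simp: sets_restrict_space)
    moreover have "(\<lambda>y::real^3. y /\<^sub>R norm y) \<in> borel_measurable borel"
      by measurable
    ultimately have "(\<lambda>y::real^3. y /\<^sub>R norm y) -` E \<inter> space borel \<in> sets borel"
      by (rule measurable_sets[rotated])
    then have "(cball 0 1 - {0}) \<inter> ((\<lambda>y::real^3. y /\<^sub>R norm y) -` E \<inter> space borel) \<in> sets borel"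
      by (intro sets.Int) auto
    also have "(cball 0 1 - {0}) \<inter> ((\<lambda>y::real^3. y /\<^sub>R norm y) -` E \<inter> space borel) = C E"
      by (auto simp: C_def)
    finally show ?thesis .
  qed
  have linT: "linear T" and bijT: "bij T" and normT: "\<And>v. norm (T v) = norm v"
    using T by (auto simp: orthogonal_transformation_linear orthogonal_transformation_bij
        orthogonal_transformation_norm)
  have invT: "orthogonal_transformation (inv T)"
    using T by (rule orthogonal_transformation_inv)
  have TE: "T ` E \<in> sets (restrict_space borel S2)"
  proof -
    have "E \<subseteq> S2" and "E \<in> sets borel"
      using E by (auto simp: sets_restrict_space)
    moreover have "inv T \<in> borel_measurable borel"
      using invT by (intro borel_measurable_continuous_onI linear_continuous_on
          linear_conv_bounded_linear[THEN iffD1] orthogonal_transformation_linear)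
    ultimately have "inv T -` E \<inter> space borel \<in> sets borel"
      using measurable_sets by blast
    also have "inv T -` E \<inter> space borel = T ` E"
      using bijT by (simp add: bij_vimage_eq_inv_image bij_imp_bij_inv inv_inv_eq)
    finally show ?thesis
      using \<open>E \<subseteq> S2\<close> normT by (auto simp: sets_restrict_space_iff)
  qed
  have CT: "C (T ` E) = T ` C E"
  proof (intro equalityI subsetI)
    fix y assume y: "y \<in> C (T ` E)"
    obtain z where z: "y = T z" using bijT by (metis bij_pointE)
    have "T (z /\<^sub>R norm z) \<in> T ` E"
      using y z normT by (simp add: C_def linear_scale[OF linT])
    then have "z /\<^sub>R norm z \<in> E"
      using bijT by (metis bij_is_inj inj_image_mem_iff)
    then show "y \<in> T ` C E"
      using y z normT linear_0[OF linT] by (auto simp: C_def)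
  next
    fix y assume "y \<in> T ` C E"
    then obtain z where z: "y = T z" "z \<in> C E" by auto
    then have "T z /\<^sub>R norm (T z) = T (z /\<^sub>R norm z)"
      using normT by (simp add: linear_scale[OF linT])
    then show "y \<in> C (T ` E)"
      using z normT by (auto simp: C_def) (metis norm_eq_zero)
  qed
  have E': "E \<in> sets (restrict_space borel S2)"
    using E by simp
  have fin: "C E \<in> lmeasurable" if "E \<in> sets (restrict_space borel S2)" for E
  proof (rule bounded_set_imp_lmeasurable)
    show "bounded (C E)"
      by (rule bounded_subset[OF bounded_cball[of 0 1]]) (auto simp: C_def)
    show "C E \<in> sets lebesgue"
      using C_borel[OF that] by simp
  qed
  have lb: "emeasure lborel (C E) = ennreal (measure lebesgue (C E))"
    if "E \<in> sets (restrict_space borel S2)" for E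
  proof -
    have "emeasure lborel (C E) = emeasure lebesgue (C E)"
      using C_borel[OF that] by simp
    then show ?thesis
      using fin[OF that] by (simp add: emeasure_eq_measure2 fmeasurableD)
  qed
  have "measure lebesgue (C (T ` E)) = measure lebesgue (C E)"
    unfolding CT using T fin[OF E'] by (rule measure_orthogonal_image)
  then have "emeasure lborel (C (T ` E)) = emeasure lborel (C E)"
    using lb[OF TE] lb[OF E'] by simp
  then show ?thesis
    using emeasure_surface_measure[OF TE] emeasure_surface_measure[OF E'] by (simp add: C_def)
qed

definition sphere_integral :: "(real^3 \<Rightarrow> real) \<Rightarrow> real" where
  "sphere_integral f = (LINT y|surface_measure. f y)"

text \<open>Restrictions to the sphere of real polynomials in three variables of total degree at most
  \<open>n\<close>. Only the values on the sphere matter; a function is otherwise arbitrary off the sphere.\<close>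

definition spherical_polys :: "nat \<Rightarrow> (real^3 \<Rightarrow> real) set" where
  "spherical_polys n = {f. \<exists>c :: nat \<Rightarrow> nat \<Rightarrow> nat \<Rightarrow> real. \<forall>y\<in>S2.
     f y = (\<Sum>i\<le>n. \<Sum>j\<le>n-i. \<Sum>k\<le>n-i-j. c i j k * (y$1)^i * (y$2)^j * (y$3)^k)}"

text \<open>Node sets \<open>X\<^sub>N = {x\<^sub>1,\<dots>,x\<^sub>N}\<close> and partitions \<open>{R\<^sub>1,\<dots>,R\<^sub>N}\<close> are families over a finite index
  type with \<open>N\<close> elements. (There is no partition with \<open>N = 0\<close>.)\<close>

definition quadrature :: "('N::finite \<Rightarrow> real^3) \<Rightarrow> real^'N \<Rightarrow> (real^3 \<Rightarrow> real) \<Rightarrow> real" where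
  "quadrature x w f = (\<Sum>j\<in>UNIV. w$j * f (x j))"

definition abs_weights :: "real^'N \<Rightarrow> real^'N" where
  "abs_weights w = (\<chi> j. \<bar>w$j\<bar>)"

definition L2_MZ_inequality ::
  "('N::finite \<Rightarrow> real^3) \<Rightarrow> real^'N \<Rightarrow> nat \<Rightarrow> real \<Rightarrow> real \<Rightarrow> bool" where
  "L2_MZ_inequality x w n A B \<longleftrightarrow> A \<le> 1 \<and> 1 \<le> B \<and>
     (\<forall>f\<in>spherical_polys n.
        A * sphere_integral (\<lambda>y. (f y)\<^sup>2) \<le> quadrature x w (\<lambda>y. (f y)\<^sup>2) \<and>
        quadrature x w (\<lambda>y. (f y)\<^sup>2) \<le> B * sphere_integral (\<lambda>y. (f y)\<^sup>2))"

definition L2_MZ_condition ::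
  "('N::finite \<Rightarrow> real^3) \<Rightarrow> real^'N \<Rightarrow> nat \<Rightarrow> real \<Rightarrow> bool" where
  "L2_MZ_condition x w n c \<longleftrightarrow> 0 \<le> c \<and>
     (\<forall>f\<in>spherical_polys n.
        quadrature x (abs_weights w) (\<lambda>y. (f y)\<^sup>2) \<le> c * sphere_integral (\<lambda>y. (f y)\<^sup>2))"

text \<open>Closedness and interiors are taken in the subspace topology of the sphere.\<close>

definition sphere_partition :: "('N::finite \<Rightarrow> (real^3) set) \<Rightarrow> bool" where
  "sphere_partition R \<longleftrightarrow>
     (\<forall>j. closedin (top_of_set S2) (R j)) \<and>
     (\<forall>i j. i \<noteq> j \<longrightarrow>
        (top_of_set S2) interior_of (R i) \<inter> (top_of_set S2) interior_of (R j) = {}) \<and>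
     (\<Union>j. R j) = S2"

definition compatible_partition ::
  "('N::finite \<Rightarrow> real^3) \<Rightarrow> ('N \<Rightarrow> (real^3) set) \<Rightarrow> bool" where
  "compatible_partition x R \<longleftrightarrow> sphere_partition R \<and>
     (\<forall>j. range x \<inter> (top_of_set S2) interior_of (R j) = {x j})"

definition partition_weight :: "('N::finite \<Rightarrow> (real^3) set) \<Rightarrow> real^'N" where
  "partition_weight R = (\<chi> j. measure surface_measure (R j))"

definition chi2_divergence :: "('N::finite \<Rightarrow> (real^3) set) \<Rightarrow> real^'N \<Rightarrow> real" where
  "chi2_divergence R w =
     sqrt (\<Sum>j\<in>UNIV. (w$j - partition_weight R $ j)\<^sup>2 / partition_weight R $ j)"

end

theory Submission
  imports Defs
begin

text \<open>The point is the sharp bound \<open>f(x)\<^sup>2 \<le> (n+1)\<^sup>2/(4\<pi>) I(f\<^sup>2)\<close> on \<open>\<P>\<^sub>n\<close>. Let \<open>K(y)\<close> be the sum of the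
  \<open>e\<^sub>i(y)\<^sup>2\<close> over an orthonormal basis. By Cauchy-Schwarz \<open>g(y)\<^sup>2 \<le> K(y) I(g\<^sup>2)\<close>; applying this to
  \<open>g = f \<circ> T\<close> for a rotation \<open>T\<close> taking \<open>y\<close> to \<open>x\<close> gives \<open>f(x)\<^sup>2 \<le> K(y) I(f\<^sup>2)\<close> for every \<open>y\<close>, and
  integrating over \<open>y\<close> gives the bound, as \<open>I(K)\<close> is the dimension. Eliminating \<open>y\<^sub>3\<^sup>2 = 1 - y\<^sub>1\<^sup>2 - y\<^sub>2\<^sup>2\<close> shows
  that the dimension is at most \<open>(n+1)\<^sup>2\<close>. The perturbation \<open>\<Sum>(w\<^sub>j - r\<^sub>j) f(x\<^sub>j)\<^sup>2\<close> is then controlled by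
  Cauchy-Schwarz with weights \<open>r\<^sub>j\<close>, using \<open>\<Sum>r\<^sub>j f(x\<^sub>j)\<^sup>4 \<le> \<parallel>f\<parallel>\<^sub>\<infinity>\<^sup>2 B I(f\<^sup>2)\<close>.\<close>

section \<open>Positivity and integration for the surface measure\<close>

interpretation surface: finite_measure surface_measure
  by (rule finite_measureI) (simp add: emeasure_surface_measure_S2)

lemma measure_surface_measure_S2: "measure surface_measure S2 = 4 * pi"
  by (simp add: measure_def emeasure_surface_measure_S2)

text \<open>The cone over a nonempty relatively open set contains a nonempty open subset of the
  ball, which has positive Lebesgue measure. This is used twice: it makes the square integral
  definite on continuous functions, and it makes partition weights positive.\<close>

lemma emeasure_surface_measure_open_pos:
  assumes U: "openin (top_of_set S2) U" and "U \<noteq> {}"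
  shows "emeasure surface_measure U > 0"
proof -
  obtain V where V: "open V" "U = S2 \<inter> V"
    using U by (auto simp: openin_open)
  \<comment> \<open>The measure is defined by the cone in the closed ball; the open ball is taken
    here so that the cone is open, and monotonicity closes the gap.\<close>
  let ?C = "{y \<in> ball 0 1 - {0}. y /\<^sub>R norm y \<in> V} :: (real^3) set"
  have "U \<in> sets (restrict_space borel S2)"
    using V by (auto simp: sets_restrict_space)
  then have eq: "emeasure surface_measure U
      = 3 * emeasure lborel {y \<in> cball 0 1 - {0}. y /\<^sub>R norm y \<in> U}"
    by (rule emeasure_surface_measure)
  have "continuous_on (ball 0 1 - {0}) (\<lambda>y::real^3. y /\<^sub>R norm y)"
    by (intro continuous_intros) auto
  moreover have "open (ball 0 1 - {0::real^3})"
    by auto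
  ultimately have "open ((\<lambda>y. y /\<^sub>R norm y) -` V \<inter> (ball 0 1 - {0}))"
    using V(1) continuous_on_open_vimage by blast
  also have "(\<lambda>y. y /\<^sub>R norm y) -` V \<inter> (ball 0 1 - {0}) = ?C"
    by auto
  finally have op: "open ?C" .
  obtain u where u: "u \<in> U"
    using assms by auto
  then have "norm u = 1" "u \<in> V"
    using V by auto
  \<comment> \<open>Halving \<open>u\<close> moves it into the open ball without changing its radial
    projection.\<close>
  then have "(1/2) *\<^sub>R u \<in> ?C"
    by auto
  then have "\<not> negligible ?C"
    using op open_not_negligible by blast
  then have "emeasure lborel ?C \<noteq> 0"
    using op by (simp add: negligible_iff_emeasure0)
  moreover have "emeasure lborel ?C \<le> emeasure lborel {y \<in> cball 0 1 - {0}. y /\<^sub>R norm y \<in> U}"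
  proof (rule emeasure_mono)
    have "{y \<in> cball 0 1 - {0}. y /\<^sub>R norm y \<in> U}
        = (\<lambda>y. y /\<^sub>R norm y) -` V \<inter> space borel \<inter> (cball 0 1 - {0})"
      using V by auto
    moreover have "(\<lambda>y::real^3. y /\<^sub>R norm y) -` V \<inter> space borel \<in> sets borel"
      using V(1) by (intro measurable_sets[where A = borel]) auto
    ultimately show "{y \<in> cball 0 1 - {0}. y /\<^sub>R norm y \<in> U} \<in> sets lborel"
      by auto
  qed (use V in auto)
  ultimately show ?thesis
    using eq by (auto simp: zero_less_iff_neq_zero ennreal_zero_less_mult_iff)
qed

lemma integrable_surface_measure:
  assumes "continuous_on S2 f"
  shows "integrable surface_measure (f :: _ \<Rightarrow> real)"
proof -
  have "compact (f ` S2)"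
    using assms by (intro compact_continuous_image) auto
  then obtain b where b: "\<forall>z\<in>f ` S2. norm z \<le> b"
    using compact_imp_bounded bounded_iff by blast
  show ?thesis
  proof (rule surface.integrable_const_bound[where B = b])
    show "AE y in surface_measure. norm (f y) \<le> b"
      using b by (intro AE_I2) auto
    show "f \<in> borel_measurable surface_measure"
      using borel_measurable_continuous_on_restrict[OF assms]
      by (simp cong: measurable_cong_sets)
  qed
qed

lemma sphere_integral_cong:
  "(\<And>y. y \<in> S2 \<Longrightarrow> f y = g y) \<Longrightarrow> sphere_integral f = sphere_integral g"
  unfolding sphere_integral_def by (rule Bochner_Integration.integral_cong) auto

lemma sphere_integral_mono:
  "continuous_on S2 f \<Longrightarrow> continuous_on S2 g \<Longrightarrow> (\<And>y. y \<in> S2 \<Longrightarrow> f y \<le> g y) \<Longrightarrow>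
    sphere_integral f \<le> sphere_integral g"
  unfolding sphere_integral_def by (intro integral_mono integrable_surface_measure) auto

lemma sphere_integral_nonneg: "(\<And>y. f y \<ge> 0) \<Longrightarrow> sphere_integral f \<ge> 0"
  unfolding sphere_integral_def by (rule Bochner_Integration.integral_nonneg) auto

lemma sphere_integral_const: "sphere_integral (\<lambda>y. c) = 4 * pi * c"
  unfolding sphere_integral_def by (simp add: measure_surface_measure_S2)

lemma sphere_integral_cmult: "sphere_integral (\<lambda>y. c * f y) = c * sphere_integral f"
  unfolding sphere_integral_def by simp

lemma sphere_integral_diff:
  "continuous_on S2 f \<Longrightarrow> continuous_on S2 g \<Longrightarrow>
    sphere_integral (\<lambda>y. f y - g y) = sphere_integral f - sphere_integral g"
  unfolding sphere_integral_def
  by (intro Bochner_Integration.integral_diff integrable_surface_measure)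

lemma sphere_integral_sum:
  "(\<And>i. i \<in> J \<Longrightarrow> continuous_on S2 (f i)) \<Longrightarrow>
    sphere_integral (\<lambda>y. \<Sum>i\<in>J. f i y) = (\<Sum>i\<in>J. sphere_integral (f i))"
  unfolding sphere_integral_def
  by (intro Bochner_Integration.integral_sum integrable_surface_measure)

text \<open>By continuity the set where \<open>f\<close> does not vanish is relatively open; it is
  also null, and nonempty relatively open sets are not. Gram-Schmidt needs this to recognise a
  residual of norm zero as zero at every point.\<close>

lemma sphere_integral_square_eq_0:
  assumes f: "continuous_on S2 f" and 0: "sphere_integral (\<lambda>y. (f y)\<^sup>2) = 0" and y: "y \<in> S2"
  shows "f y = 0"
proof (rule ccontr)
  assume "f y \<noteq> 0"
  let ?U = "S2 \<inter> f -` (- {0})"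
  have "openin (top_of_set S2) ?U"
    using f by (intro continuous_openin_preimage_gen) auto
  moreover have "?U \<noteq> {}"
    using y \<open>f y \<noteq> 0\<close> by auto
  ultimately have pos: "emeasure surface_measure ?U > 0"
    by (rule emeasure_surface_measure_open_pos)
  have "continuous_on S2 (\<lambda>y. (f y)\<^sup>2)"
    using f by (intro continuous_intros)
  from integral_nonneg_eq_0_iff_AE[OF integrable_surface_measure[OF this]] 0
  have "AE y in surface_measure. f y = 0"
    by (simp add: sphere_integral_def)
  moreover have "{y \<in> space surface_measure. \<not> f y = 0} = ?U"
    by auto
  moreover have "?U \<in> sets surface_measure"
    using \<open>openin (top_of_set S2) ?U\<close> by (auto simp: openin_open sets_restrict_space)
  ultimately have "emeasure surface_measure ?U = 0"
    by (simp only: AE_iff_measurable)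
  with pos show False by simp
qed

section \<open>Rotation invariance of the integral\<close>

lemma distr_surface_measure:
  assumes T: "orthogonal_transformation T"
  shows "T \<in> surface_measure \<rightarrow>\<^sub>M surface_measure"
    and "distr surface_measure surface_measure T = surface_measure"
proof -
  have norm: "norm (T v) = norm v" for v
    using T by (simp add: orthogonal_transformation_norm)
  have bij: "bij T"
    using T by (rule orthogonal_transformation_bij)
  have "T \<in> borel_measurable borel"
    using T by (intro borel_measurable_continuous_onI linear_continuous_on
        linear_conv_bounded_linear[THEN iffD1] orthogonal_transformation_linear)
  then have "T \<in> restrict_space borel S2 \<rightarrow>\<^sub>M restrict_space borel S2"
    using norm by (intro measurable_restrict_space2 measurable_restrict_space1)
      (auto simp: space_restrict_space)
  then show meas: "T \<in> surface_measure \<rightarrow>\<^sub>M surface_measure"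
    by (simp cong: measurable_cong_sets)
  show "distr surface_measure surface_measure T = surface_measure"
  proof (rule measure_eqI)
    fix E assume "E \<in> sets (distr surface_measure surface_measure T)"
    then have E: "E \<in> sets surface_measure" by simp
    then have "E \<subseteq> S2"
      using sets.sets_into_space by fastforce
    \<comment> \<open>Invariance is known for images, whereas the push-forward is about preimages. A
      preimage under \<open>T\<close> is an image under \<open>inv T\<close>, which is orthogonal as
      well.\<close>
    then have "T -` E \<inter> space surface_measure = inv T ` E"
      using bij norm by (auto simp: bij_vimage_eq_inv_image[symmetric])
    then have "emeasure (distr surface_measure surface_measure T) E
        = emeasure surface_measure (inv T ` E)"
      using meas E by (simp add: emeasure_distr)
    also have "\<dots> = emeasure surface_measure E"
      using orthogonal_transformation_inv[OF T] E by (rule surface_measure_rotation_invariant)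
    finally show "emeasure (distr surface_measure surface_measure T) E = emeasure surface_measure E" .
  qed simp
qed

lemma sphere_integral_rotate:
  assumes T: "orthogonal_transformation T" and f: "continuous_on S2 f"
  shows "sphere_integral (\<lambda>y. f (T y)) = sphere_integral f"
proof -
  have "sphere_integral f = (LINT y|distr surface_measure surface_measure T. f y)"
    by (simp add: sphere_integral_def distr_surface_measure(2)[OF T])
  also have "\<dots> = sphere_integral (\<lambda>y. f (T y))"
    unfolding sphere_integral_def
    using distr_surface_measure(1)[OF T] integrable_surface_measure[OF f]
    by (intro integral_distr) auto
  finally show ?thesis by simp
qed

section \<open>Spans of functions on the sphere\<close>

text \<open>Equality is asked on the sphere alone, so the relation between the squared coordinates
  may be used to shrink the index set. The size of \<open>J\<close> stands in for a dimension: the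
  family may be linearly dependent, and an upper bound is all that is wanted.\<close>

definition sphere_span :: "'i set \<Rightarrow> ('i \<Rightarrow> real^3 \<Rightarrow> real) \<Rightarrow> (real^3 \<Rightarrow> real) set" where
  "sphere_span J \<phi> = {f. \<exists>c. \<forall>y\<in>S2. f y = (\<Sum>i\<in>J. c i * \<phi> i y)}"

lemma sphere_span_cong:
  "f \<in> sphere_span J \<phi> \<Longrightarrow> (\<And>y. y \<in> S2 \<Longrightarrow> g y = f y) \<Longrightarrow> g \<in> sphere_span J \<phi>"
  by (simp add: sphere_span_def)

lemma sphere_span_base:
  assumes "finite J" "i \<in> J"
  shows "\<phi> i \<in> sphere_span J \<phi>"
proof -
  have "\<phi> i y = (\<Sum>k\<in>J. (if k = i then 1 else 0) * \<phi> k y)" for y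
    using assms by (simp add: if_distrib[of "\<lambda>t. t * _"] cong: if_cong)
  then show ?thesis
    unfolding sphere_span_def mem_Collect_eq
    by (intro exI[where x = "\<lambda>k. if k = i then 1 else 0"]) blast
qed

lemma sphere_span_cmult:
  assumes "f \<in> sphere_span J \<phi>"
  shows "(\<lambda>y. a * f y) \<in> sphere_span J \<phi>"
proof -
  obtain c where "\<forall>y\<in>S2. f y = (\<Sum>i\<in>J. c i * \<phi> i y)"
    using assms by (auto simp: sphere_span_def)
  then have "\<forall>y\<in>S2. a * f y = (\<Sum>i\<in>J. (a * c i) * \<phi> i y)"
    by (simp add: sum_distrib_left mult.assoc)
  then show ?thesis
    unfolding sphere_span_def mem_Collect_eq by (rule exI[where x = "\<lambda>i. a * c i"])
qed

lemma sphere_span_add: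
  assumes "f \<in> sphere_span J \<phi>" "g \<in> sphere_span J \<phi>"
  shows "(\<lambda>y. f y + g y) \<in> sphere_span J \<phi>"
proof -
  obtain c d where "\<forall>y\<in>S2. f y = (\<Sum>i\<in>J. c i * \<phi> i y)" "\<forall>y\<in>S2. g y = (\<Sum>i\<in>J. d i * \<phi> i y)"
    using assms by (auto simp: sphere_span_def)
  then have "\<forall>y\<in>S2. f y + g y = (\<Sum>i\<in>J. (c i + d i) * \<phi> i y)"
    by (simp add: sum.distrib distrib_right)
  then show ?thesis
    unfolding sphere_span_def mem_Collect_eq by (rule exI[where x = "\<lambda>i. c i + d i"])
qed

lemma sphere_span_sum:
  assumes "\<And>k. k \<in> K \<Longrightarrow> f k \<in> sphere_span J \<phi>"
  shows "(\<lambda>y. \<Sum>k\<in>K. f k y) \<in> sphere_span J \<phi>"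
  using assms
proof (induction K rule: infinite_finite_induct)
  case (insert k K)
  then show ?case by (simp add: sphere_span_add)
qed (auto simp: sphere_span_def intro!: exI[where x = "\<lambda>_. 0"])

lemma sphere_span_trans:
  assumes f: "f \<in> sphere_span J \<phi>" and \<phi>: "\<And>i. i \<in> J \<Longrightarrow> \<phi> i \<in> sphere_span K \<psi>"
  shows "f \<in> sphere_span K \<psi>"
proof -
  obtain c where c: "\<forall>y\<in>S2. f y = (\<Sum>i\<in>J. c i * \<phi> i y)"
    using f by (auto simp: sphere_span_def)
  have "(\<lambda>y. \<Sum>i\<in>J. c i * \<phi> i y) \<in> sphere_span K \<psi>"
    by (intro sphere_span_sum sphere_span_cmult \<phi>)
  then show ?thesis
    by (rule sphere_span_cong) (use c in auto)
qed

lemma continuous_on_sphere_span: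
  assumes f: "f \<in> sphere_span J \<phi>" and \<phi>: "\<And>i. i \<in> J \<Longrightarrow> continuous_on S2 (\<phi> i)"
  shows "continuous_on S2 f"
proof -
  obtain c where c: "\<forall>y\<in>S2. f y = (\<Sum>i\<in>J. c i * \<phi> i y)"
    using f by (auto simp: sphere_span_def)
  have "continuous_on S2 (\<lambda>y. \<Sum>i\<in>J. c i * \<phi> i y)"
    by (intro continuous_intros \<phi>)
  then show ?thesis
    using c continuous_on_cong[of S2 S2 f "\<lambda>y. \<Sum>i\<in>J. c i * \<phi> i y"] by simp
qed

section \<open>Gram-Schmidt and the pointwise bound for rotation-invariant spans\<close>

text \<open>Linearly dependent functions are allowed: vectors that Gram-Schmidt reduces to zero are kept
  as zeros, so that the index set does not change.\<close>

definition sphere_orthonormal :: "'i set \<Rightarrow> ('i \<Rightarrow> real^3 \<Rightarrow> real) \<Rightarrow> bool" where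
  "sphere_orthonormal J e \<longleftrightarrow> (\<forall>i\<in>J. continuous_on S2 (e i)) \<and>
     (\<forall>i\<in>J. \<forall>j\<in>J. i \<noteq> j \<longrightarrow> sphere_integral (\<lambda>y. e i y * e j y) = 0) \<and>
     (\<forall>i\<in>J. (\<forall>y\<in>S2. e i y = 0) \<or> sphere_integral (\<lambda>y. (e i y)\<^sup>2) = 1)"

text \<open>Orthogonality removes all terms but one. The square integral of \<open>e j\<close>
  remains as a factor because it is 0, not 1, for a zero member.\<close>

lemma sphere_integral_mult_orthonormal:
  assumes e: "sphere_orthonormal J e" and J: "finite J" "j \<in> J"
  shows "sphere_integral (\<lambda>y. (\<Sum>i\<in>J. c i * e i y) * e j y)
       = c j * sphere_integral (\<lambda>y. (e j y)\<^sup>2)"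
proof -
  have cont: "continuous_on S2 (e i)" if "i \<in> J" for i
    using e that by (auto simp: sphere_orthonormal_def)
  have "sphere_integral (\<lambda>y. (\<Sum>i\<in>J. c i * e i y) * e j y)
      = sphere_integral (\<lambda>y. \<Sum>i\<in>J. c i * (e i y * e j y))"
    by (simp add: sum_distrib_right mult.assoc)
  also have "\<dots> = (\<Sum>i\<in>J. sphere_integral (\<lambda>y. c i * (e i y * e j y)))"
    using J by (intro sphere_integral_sum continuous_intros cont)
  also have "\<dots> = (\<Sum>i\<in>J. if i = j then c j * sphere_integral (\<lambda>y. (e j y)\<^sup>2) else 0)"
    using e J by (intro sum.cong)
      (auto simp: sphere_integral_cmult sphere_orthonormal_def power2_eq_square)
  also have "\<dots> = c j * sphere_integral (\<lambda>y. (e j y)\<^sup>2)"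
    using J by simp
  finally show ?thesis .
qed

lemma sphere_gram_schmidt:
  assumes "finite J" "\<And>i. i \<in> J \<Longrightarrow> continuous_on S2 (\<phi> i)"
  obtains e where "sphere_orthonormal J e" "\<And>i. i \<in> J \<Longrightarrow> \<phi> i \<in> sphere_span J e"
proof -
  have "\<exists>e. sphere_orthonormal J e \<and> (\<forall>i\<in>J. \<phi> i \<in> sphere_span J e)"
    using assms
  proof (induction J)
    case empty
    then show ?case by (simp add: sphere_orthonormal_def)
  next
    case (insert m J)
    then obtain e where e: "sphere_orthonormal J e" and sp: "\<forall>i\<in>J. \<phi> i \<in> sphere_span J e"
      by auto
    have cont: "continuous_on S2 (e i)" if "i \<in> J" for i
      using e that by (auto simp: sphere_orthonormal_def)
    have cm: "continuous_on S2 (\<phi> m)"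
      using insert by simp
    \<comment> \<open>Fourier coefficients of the new function; \<open>g\<close> is its residual
      after projection onto the span of the earlier members.\<close>
    define c where "c i = sphere_integral (\<lambda>y. \<phi> m y * e i y)" for i
    define g where "g y = \<phi> m y - (\<Sum>i\<in>J. c i * e i y)" for y
    define s where "s = sphere_integral (\<lambda>y. (g y)\<^sup>2)"
    have cg: "continuous_on S2 g"
      unfolding g_def by (intro continuous_intros cm cont)
    have s0: "s \<ge> 0"
      unfolding s_def by (intro sphere_integral_nonneg) auto
    have gz: "g y = 0" if "s = 0" "y \<in> S2" for y
      using sphere_integral_square_eq_0[OF cg] that by (auto simp: s_def)
    have orth: "sphere_integral (\<lambda>y. g y * e j y) = 0" if j: "j \<in> J" for j
    proof -
      have "sphere_integral (\<lambda>y. g y * e j y)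
          = sphere_integral (\<lambda>y. \<phi> m y * e j y - (\<Sum>i\<in>J. c i * e i y) * e j y)"
        by (simp add: g_def left_diff_distrib)
      also have "\<dots> = c j - c j * sphere_integral (\<lambda>y. (e j y)\<^sup>2)"
        using j insert.hyps unfolding c_def
        by (subst sphere_integral_diff)
          (auto intro!: continuous_intros cm cont simp: sphere_integral_mult_orthonormal[OF e])
      \<comment> \<open>A nonzero \<open>e j\<close> has norm 1 and the two terms cancel; for a zero
        \<open>e j\<close> the coefficient \<open>c j\<close> is itself 0.\<close>
      also have "\<dots> = 0"
      proof (cases "\<forall>y\<in>S2. e j y = 0")
        case True
        then have "c j = sphere_integral (\<lambda>y. 0)"
          unfolding c_def by (intro sphere_integral_cong) auto
        then show ?thesis by (simp add: sphere_integral_const)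
      qed (use e j in \<open>auto simp: sphere_orthonormal_def\<close>)
      finally show ?thesis .
    qed
    \<comment> \<open>If \<open>s = 0\<close>, division by zero makes \<open>em\<close> the zero function, as wanted.\<close>
    define em where "em y = (1 / sqrt s) * g y" for y
    define e' where "e' = e(m := em)"
    have e'J: "e' i = e i" if "i \<in> J" for i
      using that insert.hyps by (auto simp: e'_def)
    have e'm: "e' m = em"
      by (simp add: e'_def)
    have em_orth: "sphere_integral (\<lambda>y. em y * e j y) = 0" if "j \<in> J" for j
      using orth[OF that] sphere_integral_cmult[of "1 / sqrt s" "\<lambda>y. g y * e j y"]
      by (simp add: em_def mult.assoc)
    have em_orth': "sphere_integral (\<lambda>y. e j y * em y) = 0" if "j \<in> J" for j
      using em_orth[OF that] by (simp add: mult.commute)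
    have em_norm: "(\<forall>y\<in>S2. em y = 0) \<or> sphere_integral (\<lambda>y. (em y)\<^sup>2) = 1"
    proof (cases "s = 0")
      case False
      have "sphere_integral (\<lambda>y. (em y)\<^sup>2) = sphere_integral (\<lambda>y. (1 / s) * (g y)\<^sup>2)"
        using s0 by (simp add: em_def power_mult_distrib power_divide)
      also have "\<dots> = 1"
        unfolding sphere_integral_cmult using False by (simp add: s_def)
      finally show ?thesis by simp
    qed (simp add: em_def)
    have cem: "continuous_on S2 em"
      unfolding em_def by (intro continuous_intros cg)
    have ortho': "sphere_orthonormal (insert m J) e'"
      using e cem em_orth em_orth' em_norm unfolding sphere_orthonormal_def
      by (auto simp: e'J e'm)
    have fin: "finite (insert m J)"
      using insert by simp
    have base: "e i \<in> sphere_span (insert m J) e'" if "i \<in> J" for i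
      using sphere_span_base[OF fin, of i e'] that by (simp add: e'J)
    have "em \<in> sphere_span (insert m J) e'"
      using sphere_span_base[OF fin, of m e'] by (simp add: e'm)
    then have "(\<lambda>y. sqrt s * em y + (\<Sum>i\<in>J. c i * e i y)) \<in> sphere_span (insert m J) e'"
      by (intro sphere_span_add sphere_span_cmult sphere_span_sum base)
    \<comment> \<open>On the sphere \<open>sqrt s * em y\<close> equals \<open>g y\<close> in both
      cases: for \<open>s = 0\<close> both sides vanish there, by definiteness.\<close>
    then have "\<phi> m \<in> sphere_span (insert m J) e'"
      by (rule sphere_span_cong) (use gz s0 in \<open>auto simp: em_def g_def\<close>)
    moreover have "\<phi> i \<in> sphere_span (insert m J) e'" if "i \<in> J" for i
      using sp that base by (auto intro: sphere_span_trans)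
    ultimately show ?case
      using ortho' by auto
  qed
  then show ?thesis
    using that by auto
qed

text \<open>Cauchy-Schwarz for the expansion of \<open>g\<close> in the family, combined with
  Parseval's identity for the first factor.\<close>

lemma orthonormal_span_square_le:
  assumes e: "sphere_orthonormal J e" and J: "finite J"
    and g: "g \<in> sphere_span J e" and y: "y \<in> S2"
  shows "(g y)\<^sup>2 \<le> sphere_integral (\<lambda>y. (g y)\<^sup>2) * (\<Sum>i\<in>J. (e i y)\<^sup>2)"
proof -
  obtain c where c: "\<And>y. y \<in> S2 \<Longrightarrow> g y = (\<Sum>i\<in>J. c i * e i y)"
    using g by (auto simp: sphere_span_def)
  have cont: "continuous_on S2 (e i)" if "i \<in> J" for i
    using e that by (auto simp: sphere_orthonormal_def)
  \<comment> \<open>\<open>s i\<close> is 0 for a zero member and 1 otherwise. The coefficient of a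
    zero member is arbitrary, so \<open>c i\<close> is replaced by \<open>c i * s i\<close>, which
    leaves \<open>g\<close> unchanged and makes Parseval's identity exact.\<close>
  define s where "s i = sphere_integral (\<lambda>y. (e i y)\<^sup>2)" for i
  have s: "s i * e i y = e i y \<and> (s i)\<^sup>2 = s i" if "i \<in> J" for i
  proof (cases "\<forall>y\<in>S2. e i y = 0")
    case True
    then have "s i = sphere_integral (\<lambda>y. 0)"
      unfolding s_def by (intro sphere_integral_cong) auto
    then show ?thesis
      using True y by (simp add: sphere_integral_const)
  qed (use e that in \<open>auto simp: sphere_orthonormal_def s_def\<close>)
  \<comment> \<open>Only one factor of the square is rearranged into a sum over \<open>j\<close>, so
    that the coefficient formula applies to each summand.\<close>
  have "sphere_integral (\<lambda>y. (g y)\<^sup>2)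
      = sphere_integral (\<lambda>y. \<Sum>j\<in>J. c j * ((\<Sum>i\<in>J. c i * e i y) * e j y))"
    by (intro sphere_integral_cong)
      (simp add: c power2_eq_square sum_distrib_left mult_ac)
  also have "\<dots> = (\<Sum>j\<in>J. sphere_integral (\<lambda>y. c j * ((\<Sum>i\<in>J. c i * e i y) * e j y)))"
    by (intro sphere_integral_sum continuous_intros cont)
  also have "\<dots> = (\<Sum>j\<in>J. (c j * s j)\<^sup>2)"
    using s by (intro sum.cong)
      (simp_all add: sphere_integral_cmult sphere_integral_mult_orthonormal[OF e J]
        power_mult_distrib power2_eq_square[of "c _"] flip: s_def)
  finally have I: "sphere_integral (\<lambda>y. (g y)\<^sup>2) = (\<Sum>j\<in>J. (c j * s j)\<^sup>2)" .
  have "g y = (\<Sum>i\<in>J. (c i * s i) * e i y)"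
    unfolding c[OF y] using s by (intro sum.cong refl) (simp add: mult.assoc)
  then show ?thesis
    unfolding I by (simp add: Cauchy_Schwarz_ineq_sum)
qed

text \<open>The kernel bound at \<open>y\<close>, applied to \<open>f\<close> composed with a
  rotation taking \<open>y\<close> to \<open>x\<close>, bounds the value at the fixed point
  \<open>x\<close> by the kernel at an arbitrary \<open>y\<close>. Averaging over \<open>y\<close>
  replaces the kernel by its mean, at most \<open>card J / (4 * pi)\<close>.\<close>

lemma rotation_invariant_span_square_le:
  assumes J: "finite J" and \<phi>: "\<And>i. i \<in> J \<Longrightarrow> continuous_on S2 (\<phi> i)"
    and rot: "\<And>f T. f \<in> sphere_span J \<phi> \<Longrightarrow> orthogonal_transformation T \<Longrightarrow>
                (\<lambda>y. f (T y)) \<in> sphere_span J \<phi>"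
    and f: "f \<in> sphere_span J \<phi>" and x: "x \<in> S2"
  shows "(f x)\<^sup>2 \<le> card J / (4 * pi) * sphere_integral (\<lambda>y. (f y)\<^sup>2)"
proof -
  obtain e where e: "sphere_orthonormal J e" and sp: "\<And>i. i \<in> J \<Longrightarrow> \<phi> i \<in> sphere_span J e"
    using sphere_gram_schmidt[of J \<phi>] J \<phi> by blast
  let ?I = "sphere_integral (\<lambda>y. (f y)\<^sup>2)"
  have cont: "continuous_on S2 (e i)" if "i \<in> J" for i
    using e that by (auto simp: sphere_orthonormal_def)
  have cf: "continuous_on S2 f"
    using f \<phi> by (rule continuous_on_sphere_span)
  have "(f x)\<^sup>2 \<le> ?I * (\<Sum>i\<in>J. (e i y)\<^sup>2)" if y: "y \<in> S2" for y
  proof -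
    have "norm y = norm x"
      using x y by simp
    then obtain T where T: "orthogonal_transformation T" "T y = x"
      using orthogonal_transformation_exists by blast
    have "(\<lambda>y. f (T y)) \<in> sphere_span J e"
      using rot[OF f T(1)] sp by (rule sphere_span_trans)
    from orthonormal_span_square_le[OF e J this y]
    have "(f x)\<^sup>2 \<le> sphere_integral (\<lambda>y. (f (T y))\<^sup>2) * (\<Sum>i\<in>J. (e i y)\<^sup>2)"
      by (simp add: T)
    also have "sphere_integral (\<lambda>y. (f (T y))\<^sup>2) = ?I"
      using T(1) cf by (intro sphere_integral_rotate continuous_intros)
    finally show ?thesis .
  qed
  \<comment> \<open>The left integrand is constant in \<open>y\<close>, so its integral is
    \<open>4 * pi\<close> times \<open>(f x)^2\<close>.\<close>
  then have "sphere_integral (\<lambda>y. (f x)\<^sup>2) \<le> sphere_integral (\<lambda>y. ?I * (\<Sum>i\<in>J. (e i y)\<^sup>2))"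
    by (intro sphere_integral_mono continuous_intros cont)
  also have "\<dots> = ?I * (\<Sum>i\<in>J. sphere_integral (\<lambda>y. (e i y)\<^sup>2))"
    unfolding sphere_integral_cmult
    by (subst sphere_integral_sum) (auto intro!: continuous_intros cont)
  \<comment> \<open>Each member contributes 1 or, if it is a zero member, 0.\<close>
  also have "\<dots> \<le> ?I * (\<Sum>i\<in>J. 1)"
  proof (intro mult_left_mono sum_mono)
    fix i assume i: "i \<in> J"
    show "sphere_integral (\<lambda>y. (e i y)\<^sup>2) \<le> 1"
    proof (cases "\<forall>y\<in>S2. e i y = 0")
      case True
      then have "sphere_integral (\<lambda>y. (e i y)\<^sup>2) = sphere_integral (\<lambda>y. 0)"
        by (intro sphere_integral_cong) auto
      then show ?thesis by (simp add: sphere_integral_const)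
    qed (use e i in \<open>auto simp: sphere_orthonormal_def\<close>)
  qed (auto intro: sphere_integral_nonneg)
  finally have "4 * pi * (f x)\<^sup>2 \<le> ?I * card J"
    by (simp add: sphere_integral_const)
  then show ?thesis
    by (simp add: field_simps)
qed

section \<open>Spherical polynomials: monomial spans, rotations and dimension\<close>

definition monom3 :: "nat \<times> nat \<times> nat \<Rightarrow> real^3 \<Rightarrow> real" where
  "monom3 = (\<lambda>(i, j, k) y. (y$1)^i * (y$2)^j * (y$3)^k)"

definition exponents :: "nat \<Rightarrow> (nat \<times> nat \<times> nat) set" where
  "exponents n = {(i, j, k). i + j + k \<le> n}"

text \<open>Exponents of the monomials that remain once every factor \<open>y3^2\<close> has been
  eliminated on the sphere.\<close>

definition reduced_exponents :: "nat \<Rightarrow> (nat \<times> nat \<times> nat) set" where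
  "reduced_exponents n = {(i, j, k). i + j + k \<le> n \<and> k \<le> 1}"

lemma finite_exponents: "finite (exponents n)"
  by (rule finite_subset[of _ "{..n} \<times> {..n} \<times> {..n}"]) (auto simp: exponents_def)

lemma finite_reduced_exponents: "finite (reduced_exponents n)"
  by (rule finite_subset[OF _ finite_exponents[of n]]) (auto simp: exponents_def reduced_exponents_def)

lemma continuous_on_monom3: "continuous_on A (monom3 p)"
  by (cases p) (auto simp: monom3_def intro!: continuous_intros)

lemma spherical_polys_eq_span: "spherical_polys n = sphere_span (exponents n) monom3"
proof -
  have ex: "exponents n = (SIGMA i:{..n}. SIGMA j:{..n-i}. {..n-i-j})"
    by (auto simp: exponents_def)
  have sum: "(\<Sum>p\<in>exponents n. c p * monom3 p y)
      = (\<Sum>i\<le>n. \<Sum>j\<le>n-i. \<Sum>k\<le>n-i-j. c (i, j, k) * (y$1)^i * (y$2)^j * (y$3)^k)" for c y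
    unfolding ex by (simp add: sum.Sigma monom3_def split_def mult.assoc)
  show ?thesis
  proof (intro equalityI subsetI)
    fix f assume "f \<in> spherical_polys n"
    then obtain c where "\<forall>y\<in>S2. f y = (\<Sum>i\<le>n. \<Sum>j\<le>n-i. \<Sum>k\<le>n-i-j. c i j k * (y$1)^i * (y$2)^j * (y$3)^k)"
      unfolding spherical_polys_def by blast
    then show "f \<in> sphere_span (exponents n) monom3"
      unfolding sphere_span_def mem_Collect_eq sum
      by (intro exI[where x = "\<lambda>(i, j, k). c i j k"]) simp
  next
    fix f assume "f \<in> sphere_span (exponents n) monom3"
    then show "f \<in> spherical_polys n"
      unfolding sphere_span_def spherical_polys_def mem_Collect_eq sum
      by (elim exE) (rule exI, assumption)
  qed
qed

lemma monom3_in_spherical_polys: "i + j + k \<le> n \<Longrightarrow> monom3 (i, j, k) \<in> spherical_polys n"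
  unfolding spherical_polys_eq_span
  by (intro sphere_span_base finite_exponents) (auto simp: exponents_def)

lemma spherical_polys_mult_coord:
  assumes "f \<in> spherical_polys n"
  shows "(\<lambda>y. y$m * f y) \<in> spherical_polys (Suc n)"
proof -
  obtain c where c: "\<forall>y\<in>S2. f y = (\<Sum>p\<in>exponents n. c p * monom3 p y)"
    using assms by (auto simp: spherical_polys_eq_span sphere_span_def)
  have "(\<lambda>y. y$m * monom3 p y) \<in> spherical_polys (Suc n)" if p: "p \<in> exponents n" for p
  proof -
    obtain i j k where ijk: "p = (i, j, k)" "i + j + k \<le> n"
      using p by (auto simp: exponents_def)
    consider "m = 1" | "m = 2" | "m = 3"
      using exhaust_3 by blast
    then show ?thesis
    proof cases
      case 1
      then have "(\<lambda>y. y$m * monom3 p y) = monom3 (Suc i, j, k)"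
        by (auto simp: ijk monom3_def)
      then show ?thesis using ijk by (simp add: monom3_in_spherical_polys)
    next
      case 2
      then have "(\<lambda>y. y$m * monom3 p y) = monom3 (i, Suc j, k)"
        by (auto simp: ijk monom3_def)
      then show ?thesis using ijk by (simp add: monom3_in_spherical_polys)
    next
      case 3
      then have "(\<lambda>y. y$m * monom3 p y) = monom3 (i, j, Suc k)"
        by (auto simp: ijk monom3_def)
      then show ?thesis using ijk by (simp add: monom3_in_spherical_polys)
    qed
  qed
  then have "(\<lambda>y. \<Sum>p\<in>exponents n. c p * (y$m * monom3 p y)) \<in> spherical_polys (Suc n)"
    unfolding spherical_polys_eq_span by (intro sphere_span_sum sphere_span_cmult)
  then show ?thesis
    unfolding spherical_polys_eq_span
    by (rule sphere_span_cong) (simp add: c sum_distrib_left mult_ac)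
qed

text \<open>Each coordinate of \<open>T y\<close> is a linear combination of the coordinates of
  \<open>y\<close>, so every factor raises the degree by at most one. Keeping a general
  \<open>f\<close> as last factor allows powers of different coordinates to be stacked.\<close>

lemma spherical_polys_mult_linear_power:
  assumes T: "linear T" and f: "f \<in> spherical_polys n"
  shows "(\<lambda>y. (T y $ m)^i * f y) \<in> spherical_polys (i + n)"
proof (induction i)
  case (Suc i)
  have comp: "T y $ m = (\<Sum>l\<in>UNIV. matrix T $ m $ l * y $ l)" for y
    using fun_cong[OF matrix_vector_mul(2)[OF T], of y, symmetric]
    by (simp add: matrix_vector_mult_def vec_eq_iff)
  have "(\<lambda>y. \<Sum>l\<in>UNIV. matrix T $ m $ l * (y $ l * ((T y $ m)^i * f y)))
      \<in> spherical_polys (Suc (i + n))"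
    using spherical_polys_mult_coord[OF Suc.IH]
    unfolding spherical_polys_eq_span by (intro sphere_span_sum sphere_span_cmult)
  moreover have "(\<Sum>l\<in>UNIV. matrix T $ m $ l * (y $ l * ((T y $ m)^i * f y)))
      = (T y $ m)^Suc i * f y" for y
    by (simp add: comp[of y] sum_distrib_right mult.assoc)
  ultimately show ?case by simp
qed (use f in simp)

lemma spherical_polys_rotate:
  assumes T: "orthogonal_transformation T" and f: "f \<in> spherical_polys n"
  shows "(\<lambda>y. f (T y)) \<in> spherical_polys n"
proof -
  obtain c where c: "\<forall>y\<in>S2. f y = (\<Sum>p\<in>exponents n. c p * monom3 p y)"
    using f by (auto simp: spherical_polys_eq_span sphere_span_def)
  have lin: "linear T" and norm: "\<And>y. norm (T y) = norm y"
    using T by (auto simp: orthogonal_transformation_linear orthogonal_transformation_norm)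
  have mon: "(\<lambda>y. monom3 p (T y)) \<in> spherical_polys n" if p: "p \<in> exponents n" for p
  proof -
    obtain i j k where ijk: "p = (i, j, k)" "i + j + k \<le> n"
      using p by (auto simp: exponents_def)
    \<comment> \<open>The constant 1 starts the stack; it is placed in degree
      \<open>n - (i + j + k)\<close> so that the degrees add up to exactly \<open>n\<close>.\<close>
    have "monom3 (0, 0, 0) \<in> spherical_polys (n - (i + j + k))"
      by (rule monom3_in_spherical_polys) simp
    then have "(\<lambda>y. (T y $ 1)^i * ((T y $ 2)^j * ((T y $ 3)^k * monom3 (0, 0, 0) y)))
        \<in> spherical_polys (i + (j + (k + (n - (i + j + k)))))"
      by (intro spherical_polys_mult_linear_power lin)
    then show ?thesis
      using ijk by (simp add: monom3_def mult.assoc)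
  qed
  then have "(\<lambda>y. \<Sum>p\<in>exponents n. c p * monom3 p (T y)) \<in> spherical_polys n"
    unfolding spherical_polys_eq_span by (intro sphere_span_sum sphere_span_cmult)
  then show ?thesis
    unfolding spherical_polys_eq_span
    by (rule sphere_span_cong) (simp add: c norm)
qed

text \<open>Replacing \<open>y3^2\<close> by \<open>1 - y1^2 - y2^2\<close> lowers the exponent of
  \<open>y3\<close> by two and does not raise the total degree; hence strong induction on
  \<open>k\<close> with \<open>i\<close> and \<open>j\<close> free.\<close>

lemma monom3_in_reduced_span:
  "i + j + k \<le> n \<Longrightarrow> monom3 (i, j, k) \<in> sphere_span (reduced_exponents n) monom3"
proof (induction k arbitrary: i j rule: less_induct)
  case (less k)
  show ?case
  proof (cases "k \<le> 1")
    case True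
    then show ?thesis
      using less.prems
      by (intro sphere_span_base finite_reduced_exponents) (auto simp: reduced_exponents_def)
  next
    case False
    then obtain l where l: "k = Suc (Suc l)"
      by (metis One_nat_def le_SucI le_zero_eq nat_le_linear not0_implies_Suc)
    have "(\<lambda>y. monom3 (i, j, l) y + ((-1) * monom3 (i + 2, j, l) y + (-1) * monom3 (i, j + 2, l) y))
        \<in> sphere_span (reduced_exponents n) monom3"
      using less.prems l by (intro sphere_span_add sphere_span_cmult less.IH) auto
    then show ?thesis
    proof (rule sphere_span_cong)
      fix y :: "real^3" assume "y \<in> S2"
      then have "(y$1)\<^sup>2 + (y$2)\<^sup>2 + (y$3)\<^sup>2 = 1"
        by (simp add: norm_eq_sqrt_inner inner_vec_def sum_3 power2_eq_square)
      then have y3: "(y$3)^k = (y$3)^l * (1 - (y$1)\<^sup>2 - (y$2)\<^sup>2)"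
        by (simp add: l power2_eq_square flip: eq_diff_eq add.assoc)
      show "monom3 (i, j, k) y = monom3 (i, j, l) y
          + ((-1) * monom3 (i + 2, j, l) y + (-1) * monom3 (i, j + 2, l) y)"
        by (simp add: monom3_def y3 power_add power2_eq_square algebra_simps)
    qed
  qed
qed

lemma spherical_polys_eq_reduced_span:
  "spherical_polys n = sphere_span (reduced_exponents n) monom3"
proof (intro equalityI subsetI)
  fix f assume "f \<in> spherical_polys n"
  then show "f \<in> sphere_span (reduced_exponents n) monom3"
    unfolding spherical_polys_eq_span
    by (rule sphere_span_trans) (auto simp: exponents_def intro: monom3_in_reduced_span)
next
  fix f assume "f \<in> sphere_span (reduced_exponents n) monom3"
  then show "f \<in> spherical_polys n"
    unfolding spherical_polys_eq_span
    by (rule sphere_span_trans)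
      (auto simp: reduced_exponents_def monom3_in_spherical_polys simp flip: spherical_polys_eq_span)
qed

text \<open>From \<open>n\<close> to \<open>n + 1\<close> the new triples have total degree exactly
  \<open>n + 1\<close>: there are \<open>n + 2\<close> with \<open>k = 0\<close> and
  \<open>n + 1\<close> with \<open>k = 1\<close>, and \<open>2 * n + 3\<close> is the difference of
  consecutive squares.\<close>

lemma card_reduced_exponents: "card (reduced_exponents n) \<le> (n + 1)\<^sup>2"
proof (induction n)
  case 0
  have "reduced_exponents 0 = {(0, 0, 0)}"
    by (auto simp: reduced_exponents_def)
  then show ?case by simp
next
  case (Suc n)
  let ?A = "(\<lambda>i. (i, Suc n - i, 0::nat)) ` {..Suc n}"
  let ?B = "(\<lambda>i. (i, n - i, 1::nat)) ` {..n}"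
  have "reduced_exponents (Suc n) \<subseteq> reduced_exponents n \<union> (?A \<union> ?B)"
    by (auto simp: reduced_exponents_def image_iff le_Suc_eq)
  then have "card (reduced_exponents (Suc n)) \<le> card (reduced_exponents n \<union> (?A \<union> ?B))"
    by (intro card_mono) (auto simp: finite_reduced_exponents)
  also have "\<dots> \<le> card (reduced_exponents n) + (card ?A + card ?B)"
    by (rule order_trans[OF card_Un_le add_left_mono[OF card_Un_le]])
  also have "\<dots> \<le> (n + 1)\<^sup>2 + ((n + 2) + (n + 1))"
    using card_image_le[of "{..Suc n}" "\<lambda>i. (i, Suc n - i, 0::nat)"]
      card_image_le[of "{..n}" "\<lambda>i. (i, n - i, 1::nat)"] Suc.IH
    by (intro add_mono) auto
  also have "\<dots> = (Suc n + 1)\<^sup>2"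
    by (simp add: power2_eq_square)
  finally show ?case .
qed

text \<open>The general bound is applied to the reduced family, whose size is quadratic in
  \<open>n\<close>; the full set of exponents grows cubically.\<close>

lemma spherical_polys_square_le:
  assumes f: "f \<in> spherical_polys n" and x: "x \<in> S2"
  shows "(f x)\<^sup>2 \<le> (real n + 1)\<^sup>2 / (4 * pi) * sphere_integral (\<lambda>y. (f y)\<^sup>2)"
proof -
  have "(f x)\<^sup>2 \<le> card (reduced_exponents n) / (4 * pi) * sphere_integral (\<lambda>y. (f y)\<^sup>2)"
    using f x spherical_polys_rotate unfolding spherical_polys_eq_reduced_span
    by (intro rotation_invariant_span_square_le[where \<phi> = monom3]
        finite_reduced_exponents continuous_on_monom3) auto
  also have "\<dots> \<le> (real n + 1)\<^sup>2 / (4 * pi) * sphere_integral (\<lambda>y. (f y)\<^sup>2)"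
  proof (intro mult_right_mono divide_right_mono sphere_integral_nonneg)
    have "real (card (reduced_exponents n)) \<le> real ((n + 1)\<^sup>2)"
      using card_reduced_exponents of_nat_le_iff by blast
    then show "real (card (reduced_exponents n)) \<le> (real n + 1)\<^sup>2"
      by (simp add: add.commute)
  qed auto
  finally show ?thesis .
qed

section \<open>Partition weights and perturbation of the quadrature\<close>

text \<open>The relative interior of \<open>R j\<close> contains \<open>x j\<close>, so it is a
  nonempty relatively open set. Positivity justifies the divisions in the divergence.\<close>

lemma partition_weight_pos:
  assumes "compatible_partition x R"
  shows "partition_weight R $ j > 0"
proof -
  let ?U = "(top_of_set S2) interior_of (R j)"
  have "x j \<in> ?U" and cl: "closedin (top_of_set S2) (R j)"
    using assms by (auto simp: compatible_partition_def sphere_partition_def)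
  then have "emeasure surface_measure ?U > 0"
    by (intro emeasure_surface_measure_open_pos) auto
  also have "emeasure surface_measure ?U \<le> emeasure surface_measure (R j)"
  proof (rule emeasure_mono)
    show "R j \<in> sets surface_measure"
      using cl by (auto simp: closedin_closed sets_restrict_space intro: borel_closed)
  qed (rule interior_of_subset)
  finally show ?thesis
    by (simp add: partition_weight_def surface.emeasure_eq_measure)
qed

lemma weight_perturbation_le:
  assumes r: "\<And>j. partition_weight R $ j > 0"
    and M: "\<And>j. (f (x j))\<^sup>2 \<le> M" and Q: "quadrature x (partition_weight R) (\<lambda>y. (f y)\<^sup>2) \<le> Q"
  shows "(\<Sum>j\<in>UNIV. \<bar>w$j - partition_weight R $ j\<bar> * (f (x j))\<^sup>2) \<le> chi2_divergence R w * sqrt (M * Q)"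
proof -
  define r where "r j = partition_weight R $ j" for j
  have r0: "r j > 0" for j
    using r by (simp add: r_def)
  \<comment> \<open>An index type is never empty, so \<open>M\<close> dominates at least one
    square.\<close>
  have M0: "M \<ge> 0"
    using M[of undefined] zero_le_power2 order_trans by blast
  \<comment> \<open>The weight is split so that the squares of \<open>?a\<close> sum to the squared
    divergence and those of \<open>?b\<close> to the quadrature of the fourth power of
    \<open>f\<close>.\<close>
  let ?a = "\<lambda>j. \<bar>w$j - r j\<bar> / sqrt (r j)" and ?b = "\<lambda>j. sqrt (r j) * (f (x j))\<^sup>2"
  have "(\<Sum>j\<in>UNIV. \<bar>w$j - r j\<bar> * (f (x j))\<^sup>2) = (\<Sum>j\<in>UNIV. ?a j * ?b j)"
    using r0 by (intro sum.cong) (auto simp: less_le)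
  also have "\<dots> \<le> sqrt ((\<Sum>j\<in>UNIV. (?a j)\<^sup>2) * (\<Sum>j\<in>UNIV. (?b j)\<^sup>2))"
    using Cauchy_Schwarz_ineq_sum by (rule real_le_rsqrt)
  also have "\<dots> = sqrt (\<Sum>j\<in>UNIV. (?a j)\<^sup>2) * sqrt (\<Sum>j\<in>UNIV. (?b j)\<^sup>2)"
    by (rule real_sqrt_mult)
  also have "sqrt (\<Sum>j\<in>UNIV. (?a j)\<^sup>2) = chi2_divergence R w"
    using r0 by (simp add: chi2_divergence_def power_divide less_imp_le flip: r_def)
  also have "\<dots> * sqrt (\<Sum>j\<in>UNIV. (?b j)\<^sup>2) \<le> \<dots> * sqrt (M * Q)"
  proof (intro mult_left_mono real_sqrt_le_mono)
    have "(\<Sum>j\<in>UNIV. (?b j)\<^sup>2) = (\<Sum>j\<in>UNIV. (f (x j))\<^sup>2 * (r j * (f (x j))\<^sup>2))"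
      using r0 by (intro sum.cong) (auto simp: power_mult_distrib less_imp_le power2_eq_square[of "(f _)\<^sup>2"])
    \<comment> \<open>One square out of the fourth power is bounded by \<open>M\<close>; the other
      stays for the quadrature.\<close>
    also have "\<dots> \<le> (\<Sum>j\<in>UNIV. M * (r j * (f (x j))\<^sup>2))"
      using r0 M by (intro sum_mono mult_right_mono) (auto simp: less_imp_le)
    also have "\<dots> = M * quadrature x (partition_weight R) (\<lambda>y. (f y)\<^sup>2)"
      by (simp add: quadrature_def sum_distrib_left r_def)
    also have "\<dots> \<le> M * Q"
      using Q M0 by (rule mult_left_mono)
    finally show "(\<Sum>j\<in>UNIV. (?b j)\<^sup>2) \<le> M * Q" .
  qed (use r0 in \<open>simp add: chi2_divergence_def less_imp_le sum_nonneg flip: r_def\<close>)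
  finally show ?thesis
    by (simp add: r_def)
qed

theorem proposition5p10:
  fixes x :: "'N::finite \<Rightarrow> real^3"
    and R :: "'N \<Rightarrow> (real^3) set"
    and w :: "real^'N"
    and n :: nat
    and A B :: real
  assumes "inj x" and "range x \<subseteq> S2"
    and "compatible_partition x R"
    and "L2_MZ_inequality x (partition_weight R) n A B"
  shows "(\<forall>f\<in>spherical_polys n.
      (A - (real n + 1) * sqrt B / sqrt (4 * pi) * chi2_divergence R w)
          * sphere_integral (\<lambda>y. (f y)\<^sup>2)
        \<le> quadrature x w (\<lambda>y. (f y)\<^sup>2) \<and>
      quadrature x w (\<lambda>y. (f y)\<^sup>2) \<le> quadrature x (abs_weights w) (\<lambda>y. (f y)\<^sup>2) \<and>
      quadrature x (abs_weights w) (\<lambda>y. (f y)\<^sup>2)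
        \<le> (B + (real n + 1) * sqrt B / sqrt (4 * pi) * chi2_divergence R w)
          * sphere_integral (\<lambda>y. (f y)\<^sup>2)) \<and>
    L2_MZ_inequality x w n
      (A - (real n + 1) * sqrt B / sqrt (4 * pi) * chi2_divergence R w)
      (B + (real n + 1) * sqrt B / sqrt (4 * pi) * chi2_divergence R w) \<and>
    L2_MZ_condition x w n
      (B + (real n + 1) * sqrt B / sqrt (4 * pi) * chi2_divergence R w)"
proof -
  let ?chi = "chi2_divergence R w" and ?I = "\<lambda>f. sphere_integral (\<lambda>y. (f y)\<^sup>2)"
  define r where "r = partition_weight R"
  define D where "D = (real n + 1) * sqrt B / sqrt (4 * pi) * ?chi"
  have AB: "A \<le> 1" "1 \<le> B"
    and MZ: "\<And>f. f \<in> spherical_polys n \<Longrightarrow>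
      A * ?I f \<le> quadrature x r (\<lambda>y. (f y)\<^sup>2) \<and> quadrature x r (\<lambda>y. (f y)\<^sup>2) \<le> B * ?I f"
    using assms(4) by (auto simp: L2_MZ_inequality_def r_def)
  have r0: "r $ j > 0" for j
    using partition_weight_pos[OF assms(3)] by (simp add: r_def)
  have "?chi \<ge> 0"
    using r0 by (auto simp: chi2_divergence_def r_def less_imp_le intro!: sum_nonneg)
  then have D0: "D \<ge> 0"
    using AB by (simp add: D_def)
  have main: "(A - D) * ?I f \<le> quadrature x w (\<lambda>y. (f y)\<^sup>2) \<and>
      quadrature x w (\<lambda>y. (f y)\<^sup>2) \<le> quadrature x (abs_weights w) (\<lambda>y. (f y)\<^sup>2) \<and>
      quadrature x (abs_weights w) (\<lambda>y. (f y)\<^sup>2) \<le> (B + D) * ?I f"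
    if f: "f \<in> spherical_polys n" for f
  proof -
    define M where "M = (real n + 1)\<^sup>2 / (4 * pi) * ?I f"
    define E where "E = (\<Sum>j\<in>UNIV. \<bar>w$j - r$j\<bar> * (f (x j))\<^sup>2)"
    have I0: "?I f \<ge> 0"
      by (intro sphere_integral_nonneg) auto
    have "(f (x j))\<^sup>2 \<le> M" for j
      unfolding M_def using assms(2) by (intro spherical_polys_square_le f) blast
    then have "E \<le> ?chi * sqrt (M * (B * ?I f))"
      unfolding E_def r_def using r0 MZ[OF f] by (intro weight_perturbation_le) (auto simp: r_def)
    \<comment> \<open>Both \<open>M\<close> and the quadrature bound carry a factor
      \<open>?I f\<close>, so the root is linear in \<open>?I f\<close> and yields the constant
      \<open>D\<close>.\<close>
    also have "M * (B * ?I f) = ((real n + 1) * ?I f)\<^sup>2 * B / (4 * pi)"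
      by (simp add: M_def power2_eq_square)
    also have "?chi * sqrt \<dots> = D * ?I f"
      using I0 by (simp add: D_def real_sqrt_mult real_sqrt_divide)
    finally have E: "E \<le> D * ?I f" .
    \<comment> \<open>Termwise, \<open>w\<close> is at least \<open>r - \<bar>w - r\<bar>\<close>;
      for the upper bound below, the triangle inequality gives
      \<open>\<bar>w\<bar> \<le> r + \<bar>w - r\<bar>\<close>, since \<open>r\<close> is
      positive.\<close>
    have "quadrature x r (\<lambda>y. (f y)\<^sup>2) - E \<le> quadrature x w (\<lambda>y. (f y)\<^sup>2)"
      unfolding quadrature_def E_def sum_subtractf[symmetric] left_diff_distrib[symmetric]
      by (intro sum_mono mult_right_mono) auto
    moreover have "quadrature x (abs_weights w) (\<lambda>y. (f y)\<^sup>2) \<le> quadrature x r (\<lambda>y. (f y)\<^sup>2) + E"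
      unfolding quadrature_def E_def sum.distrib[symmetric] distrib_right[symmetric] abs_weights_def
    proof (intro sum_mono mult_right_mono)
      show "(\<chi> j. \<bar>w $ j\<bar>) $ j \<le> r $ j + \<bar>w $ j - r $ j\<bar>" for j
        using r0[of j] by simp
    qed auto
    moreover have "quadrature x w (\<lambda>y. (f y)\<^sup>2) \<le> quadrature x (abs_weights w) (\<lambda>y. (f y)\<^sup>2)"
      unfolding quadrature_def abs_weights_def by (intro sum_mono mult_right_mono) auto
    ultimately show ?thesis
      using MZ[OF f] E by (simp add: left_diff_distrib distrib_right)
  qed
  \<comment> \<open>As \<open>D\<close> is nonnegative, \<open>A - D \<le> 1 \<le> B + D\<close>
    follows from the same bounds on \<open>A\<close> and \<open>B\<close>.\<close>
  have "L2_MZ_inequality x w n (A - D) (B + D)"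
    unfolding L2_MZ_inequality_def using AB D0 main by (auto intro: order_trans)
  moreover have "L2_MZ_condition x w n (B + D)"
    unfolding L2_MZ_condition_def using AB D0 main by auto
  ultimately show ?thesis
    using main unfolding D_def by blast
qed

end
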